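(* A semigroup $S\subseteq\mathbb{N}$ is dimension-$2$ realizable if and only if it is a Lucas semigroup, i.e., $S=\mathcal{L}(P,Q,R)$ for some $P,Q\in\mathbb{Z}$ and $R\in\mathbb{Q}$.
   Context: $\mathbb{N}=\{0,1,2,\ldots\}$; a semigroup is an additive submonoid of $\mathbb{N}$. For $P,Q\in\mathbb{Z}$, the Lucas sequence $U_n=U_n(P,Q)$ is defined by $U_0=0$, $U_1=1$, $U_{n+2}=PU_{n+1}-QU_n$. For $R\in\mathbb{Q}$, $\mathcal{L}(P,Q,R)=\{n\in\mathbb{N} : U_nR\in\mathbb{Z}\}$. For $A\in\mathrm{M}_d(\mathbb{Q})$, $\mathcal{S}(A)=\{n\in\mathbb{N}: A^n\in\mathrm{M}_d(\mathbb{Z})\}$. A semigroup $S$ is dimension-$2$ realizable if $S=\mathcal{S}(A)$ for some $A\in\mathrm{M}_2(\mathbb{Q})$. *)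

theory Defs
  imports "Jordan_Normal_Form.Matrix"
begin

definition submonoid_nat :: "nat set \<Rightarrow> bool" where
  "submonoid_nat S \<longleftrightarrow> 0 \<in> S \<and> (\<forall>m\<in>S. \<forall>n\<in>S. m + n \<in> S)"

fun lucas_U :: "int \<Rightarrow> int \<Rightarrow> nat \<Rightarrow> int" where
  "lucas_U P Q 0 = 0"
| "lucas_U P Q (Suc 0) = 1"
| "lucas_U P Q (Suc (Suc n)) = P * lucas_U P Q (Suc n) - Q * lucas_U P Q n"

definition lucas_set :: "int \<Rightarrow> int \<Rightarrow> rat \<Rightarrow> nat set" where
  "lucas_set P Q R = {n. of_int (lucas_U P Q n) * R \<in> \<int>}"

definition lucas_semigroup :: "nat set \<Rightarrow> bool" where
  "lucas_semigroup S \<longleftrightarrow> (\<exists>P Q R. S = lucas_set P Q R)"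

definition integrality_exponents :: "rat mat \<Rightarrow> nat set" where
  "integrality_exponents A = {n. elements_mat (A ^\<^sub>m n) \<subseteq> \<int>}"

definition dim_realizable :: "nat \<Rightarrow> nat set \<Rightarrow> bool" where
  "dim_realizable d S \<longleftrightarrow> (\<exists>A \<in> carrier_mat d d. S = integrality_exponents A)"

end

theory Submission
  imports Defs
begin

text \<open>
  Let \<open>A\<close> be a rational \<open>2 \<times> 2\<close> matrix with trace \<open>T\<close> and determinant \<open>D\<close>.  If some positive power
  of \<open>A\<close> is integral, then \<open>T\<close> and \<open>D\<close> are integers.  In that case Cayley--Hamilton gives
  \<open>A\<^sup>n\<^sup>+\<^sup>1 = U\<^sub>n\<^sub>+\<^sub>1 A - D U\<^sub>n I\<close> with \<open>U = U(T, D)\<close>, so \<open>A\<^sup>n\<close> is integral iff \<open>U\<^sub>n A\<close> is, that is, iff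
  the least common denominator \<open>s\<close> of the entries of \<open>A\<close> divides \<open>U\<^sub>n\<close>; hence \<open>R = 1 / s\<close>.
  Conversely, if \<open>R\<close> has denominator \<open>s\<close>, the matrix with rows \<open>(0, - Q s)\<close> and \<open>(1 / s, P)\<close> has trace
  \<open>P\<close>, determinant \<open>Q\<close> and an off-diagonal entry of denominator exactly \<open>s\<close>.
\<close>

section \<open>Denominators and integrality of rationals\<close>

lemma rat_coprime_quotient:
  fixes r :: rat
  obtains p q :: int where "q > 0" "coprime p q" "r = of_int p / of_int q"
  by (metis surj_pair quotient_of_denom_pos quotient_of_coprime quotient_of_div)

lemma of_int_mult_rat_in_Ints_iff:
  fixes r :: rat
  assumes "q \<noteq> 0" "coprime p q" "r = of_int p / of_int q"
  shows "of_int x * r \<in> \<int> \<longleftrightarrow> q dvd x"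
proof -
  have "of_int x * r = of_int (x * p) / of_int q"
    using assms by simp
  then show ?thesis
    using assms by (simp only: of_int_div_of_int_in_Ints_iff)
      (simp add: coprime_commute coprime_dvd_mult_left_iff)
qed

text \<open>The integers clearing one rational are the multiples of its reduced denominator, so
  \<open>s\<close> is the lcm of these denominators; finiteness of \<open>F\<close> keeps it
  nonzero.\<close>

lemma common_denominator:
  fixes F :: "rat set"
  assumes "finite F"
  obtains s :: int where "s \<noteq> 0" "\<And>x. (\<forall>r\<in>F. of_int x * r \<in> \<int>) \<longleftrightarrow> s dvd x"
proof -
  have "\<exists>q. q \<noteq> 0 \<and> (\<forall>x. of_int x * r \<in> \<int> \<longleftrightarrow> q dvd x)" for r :: rat
    by (metis rat_coprime_quotient[of r] of_int_mult_rat_in_Ints_iff less_irrefl)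
  then obtain d :: "rat \<Rightarrow> int" where d: "\<And>r. d r \<noteq> 0" "\<And>r x. of_int x * r \<in> \<int> \<longleftrightarrow> d r dvd x"
    by metis
  show thesis
  proof (rule that[of "Lcm (d ` F)"])
    show "Lcm (d ` F) \<noteq> 0"
      using assms d(1) by (auto simp: Lcm_0_iff)
    show "(\<forall>r\<in>F. of_int x * r \<in> \<int>) \<longleftrightarrow> Lcm (d ` F) dvd x" for x
      by (auto simp: d(2) Lcm_dvd_iff)
  qed
qed

lemma rat_in_Ints_if_power_in_Ints:
  fixes r :: rat
  assumes "r ^ n \<in> \<int>" "n > 0"
  shows "r \<in> \<int>"
proof -
  obtain p q :: int where pq: "q > 0" "coprime p q" "r = of_int p / of_int q"
    by (rule rat_coprime_quotient)
  then have "r ^ n = of_int (p ^ n) / of_int (q ^ n)"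
    by (simp add: power_divide)
  with assms(1) have "(of_int (p ^ n) / of_int (q ^ n) :: rat) \<in> \<int>"
    by simp
  then have "q ^ n dvd p ^ n"
    using pq(1) by (simp only: of_int_div_of_int_in_Ints_iff) simp
  then have "q dvd p"
    using assms(2) by simp
  then show ?thesis
    using pq(3) by (metis of_int_div_of_int_in_Ints_iff)
qed

text \<open>
  The companion sequence \<open>V\<^sub>n\<close> is a monic integer polynomial of degree \<open>n\<close> in \<open>T\<close>, so this is an instance
  of the rational root theorem: clearing the denominator \<open>q\<close> of \<open>T\<close> makes \<open>V\<^sub>n\<close> congruent to \<open>p\<^sup>n\<close>
  modulo \<open>q\<close>.
\<close>

lemma rat_in_Ints_if_companion_in_Ints:
  fixes T D :: rat and V :: "nat \<Rightarrow> rat"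
  assumes V0: "V 0 = 2" and V1: "V (Suc 0) = T"
    and rec: "\<And>k. V (Suc (Suc k)) = T * V (Suc k) - D * V k"
    and D: "D \<in> \<int>" and n: "n > 0" "V n \<in> \<int>"
  shows "T \<in> \<int>"
proof -
  obtain p q :: int where pq: "q > 0" "coprime p q" "T = of_int p / of_int q"
    by (rule rat_coprime_quotient)
  obtain e where e: "D = of_int e"
    using D by (auto elim: Ints_cases)
  have qT: "of_int q * T = of_int p"
    using pq by simp
  then have qV1: "of_int q ^ Suc 0 * V (Suc 0) = of_int p"
    by (simp add: V1)
  \<comment> \<open>The scaled sequence \<open>q ^ k * V k\<close> obeys an integer recurrence; its
    last coefficient is divisible by \<open>q\<close>, so modulo \<open>q\<close> each step just
    multiplies by \<open>p\<close>.\<close>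
  have scaled: "of_int q ^ Suc (Suc k) * V (Suc (Suc k)) =
      of_int p * (of_int q ^ Suc k * V (Suc k)) - of_int (e * q\<^sup>2) * (of_int q ^ k * V k)" for k
    unfolding rec e qT[symmetric] by (simp add: algebra_simps power2_eq_square)
  \<comment> \<open>The congruence starts at index 1: at index 0 the value is 2, not
    \<open>p ^ 0\<close>.\<close>
  have "\<exists>z. of_int q ^ Suc k * V (Suc k) = of_int (p ^ Suc k + q * z)" for k
  proof (induction k rule: induct_nat_012)
    case 0
    show ?case
      by (rule exI[of _ 0]) (simp only: qV1, simp)
  next
    case 1
    have "of_int q ^ Suc (Suc 0) * V (Suc (Suc 0)) =
        (of_int (p ^ Suc (Suc 0) + q * (- 2 * e * q)) :: rat)"
      unfolding scaled qV1 by (simp add: V0 power2_eq_square algebra_simps)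
    then show ?case ..
  next
    case (ge2 k)
    then obtain y z where
      "of_int q ^ Suc k * V (Suc k) = of_int (p ^ Suc k + q * y)"
      "of_int q ^ Suc (Suc k) * V (Suc (Suc k)) = of_int (p ^ Suc (Suc k) + q * z)"
      by blast
    then have "of_int q ^ Suc (Suc (Suc k)) * V (Suc (Suc (Suc k))) =
        of_int (p ^ Suc (Suc (Suc k)) + q * (p * z - e * q * (p ^ Suc k + q * y)))"
      unfolding scaled[of "Suc k"] by (simp add: power2_eq_square algebra_simps)
    then show ?case ..
  qed
  then obtain z where z: "of_int q ^ n * V n = of_int (p ^ n + q * z)"
    using n(1) by (metis Suc_pred)
  obtain v where "V n = of_int v"
    using n(2) by (auto elim: Ints_cases)
  with z have "of_int (q ^ n * v) = (of_int (p ^ n + q * z) :: rat)"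
    by simp
  then have "q ^ n * v = p ^ n + q * z"
    by (simp only: of_int_eq_iff)
  moreover have "q dvd q ^ n * v"
    using n(1) by (simp add: dvd_power)
  ultimately have "q dvd p ^ n"
    by (metis dvd_add_left_iff dvd_triv_left)
  moreover have "coprime q (p ^ n)"
    using pq(2) by (simp add: coprime_commute)
  ultimately have "q = 1"
    using pq(1) by (metis coprime_common_divisor dvd_refl zdvd1_eq abs_of_pos)
  then show ?thesis
    using pq(3) by simp
qed

section \<open>Powers of a two by two matrix\<close>

context
  fixes A :: "'a :: comm_ring_1 mat"
  assumes A: "A \<in> carrier_mat 2 2"
begin

lemma pow_mat_Suc_index_2:
  assumes "i < 2" "j < 2"
  shows "(A ^\<^sub>m Suc n) $$ (i, j) =
    (A ^\<^sub>m n) $$ (i, 0) * A $$ (0, j) + (A ^\<^sub>m n) $$ (i, 1) * A $$ (1, j)"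
proof -
  have "A ^\<^sub>m n \<in> carrier_mat 2 2"
    using A by simp
  then show ?thesis
    using A assms by (simp add: scalar_prod_def eval_nat_numeral)
qed

text \<open>Expanding both higher powers down to row \<open>i\<close> of
  \<open>A ^\<^sub>m n\<close> leaves a polynomial identity in the entries.\<close>

lemma pow_mat_cayley_hamilton_2:
  assumes "i < 2" "j < 2"
  shows "(A ^\<^sub>m Suc (Suc n)) $$ (i, j) =
    (A $$ (0, 0) + A $$ (1, 1)) * (A ^\<^sub>m Suc n) $$ (i, j)
    - (A $$ (0, 0) * A $$ (1, 1) - A $$ (0, 1) * A $$ (1, 0)) * (A ^\<^sub>m n) $$ (i, j)"
proof -
  have "j = 0 \<or> j = 1"
    using assms by auto
  then show ?thesis
    using assms by (auto simp: pow_mat_Suc_index_2 algebra_simps simp del: pow_mat.simps)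
qed

lemma pow_mat_0_index_2:
  assumes "i < 2" "j < 2"
  shows "(A ^\<^sub>m 0) $$ (i, j) = (if i = j then 1 else 0)"
  using A assms by simp

lemma pow_mat_1_index_2:
  assumes "i < 2" "j < 2"
  shows "(A ^\<^sub>m Suc 0) $$ (i, j) = A $$ (i, j)"
  using A assms by simp

text \<open>Multiplicativity of the determinant, in entries: an integral \<open>n\<close>-th power
  makes the \<open>n\<close>-th power of the determinant an integer.\<close>

lemma pow_mat_det_2:
  "(A ^\<^sub>m n) $$ (0, 0) * (A ^\<^sub>m n) $$ (1, 1) - (A ^\<^sub>m n) $$ (0, 1) * (A ^\<^sub>m n) $$ (1, 0) =
    (A $$ (0, 0) * A $$ (1, 1) - A $$ (0, 1) * A $$ (1, 0)) ^ n"
proof (induction n)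
  case 0
  show ?case
    using A by simp
next
  case (Suc n)
  show ?case
    unfolding power_Suc Suc.IH[symmetric] by (simp add: pow_mat_Suc_index_2 algebra_simps del: pow_mat.simps)
qed

text \<open>Both sides satisfy the recurrence with coefficients \<open>P\<close> and
  \<open>Q\<close>. The shift to \<open>Suc n\<close> avoids a Lucas number of index -1.\<close>

lemma pow_mat_eq_lucas_U:
  assumes T: "A $$ (0, 0) + A $$ (1, 1) = of_int P"
    and D: "A $$ (0, 0) * A $$ (1, 1) - A $$ (0, 1) * A $$ (1, 0) = of_int Q"
    and ij: "i < 2" "j < 2"
  shows "(A ^\<^sub>m Suc n) $$ (i, j) =
    of_int (lucas_U P Q (Suc n)) * A $$ (i, j) - (if i = j then of_int (Q * lucas_U P Q n) else 0)"
proof (induction n rule: induct_nat_012)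
  case 0
  show ?case
    using ij by (simp add: pow_mat_1_index_2 del: pow_mat.simps)
next
  case 1
  show ?case
    unfolding pow_mat_cayley_hamilton_2[OF ij] T D pow_mat_0_index_2[OF ij] pow_mat_1_index_2[OF ij]
    by simp
next
  case (ge2 n)
  show ?case
    unfolding pow_mat_cayley_hamilton_2[OF ij, of "Suc n"] T D ge2
    by (simp add: algebra_simps)
qed

end

section \<open>Integrality of matrix powers\<close>

lemma mem_integrality_exponents_iff:
  assumes "A \<in> carrier_mat d d"
  shows "n \<in> integrality_exponents A \<longleftrightarrow> (\<forall>i<d. \<forall>j<d. (A ^\<^sub>m n) $$ (i, j) \<in> \<int>)"
proof -
  have "elements_mat B \<subseteq> \<int> \<longleftrightarrow> (\<forall>i<d. \<forall>j<d. B $$ (i, j) \<in> \<int>)"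
    if "B \<in> carrier_mat d d" for B :: "rat mat"
    using that by (auto dest!: elements_matD intro: elements_matI)
  moreover have "A ^\<^sub>m n \<in> carrier_mat d d"
    using assms by simp
  ultimately show ?thesis
    unfolding integrality_exponents_def by blast
qed

text \<open>The scalar matrix subtracted in \<open>pow_mat_eq_lucas_U\<close> is integral, so only
  the multiple of \<open>A\<close> matters. For \<open>n = 0\<close> both sides hold.\<close>

lemma mem_integrality_exponents_iff_lucas_U:
  assumes A: "A \<in> carrier_mat 2 2"
    and T: "A $$ (0, 0) + A $$ (1, 1) = of_int P"
    and D: "A $$ (0, 0) * A $$ (1, 1) - A $$ (0, 1) * A $$ (1, 0) = of_int Q"
  shows "n \<in> integrality_exponents A \<longleftrightarrow> (\<forall>i<2. \<forall>j<2. of_int (lucas_U P Q n) * A $$ (i, j) \<in> \<int>)"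
proof (cases n)
  case 0
  then show ?thesis
    using A by (simp add: mem_integrality_exponents_iff)
next
  case (Suc m)
  have "(A ^\<^sub>m Suc m) $$ (i, j) \<in> \<int> \<longleftrightarrow> of_int (lucas_U P Q (Suc m)) * A $$ (i, j) \<in> \<int>"
    if "i < 2" "j < 2" for i j
  proof -
    have "x - of_int z \<in> \<int> \<longleftrightarrow> x \<in> \<int>" for x :: rat and z :: int
      by (metis Ints_add Ints_diff Ints_of_int diff_add_cancel)
    then show ?thesis
      unfolding pow_mat_eq_lucas_U[OF A T D that] by (simp del: of_int_mult)
  qed
  then show ?thesis
    unfolding Suc mem_integrality_exponents_iff[OF A] by blast
qed

lemma trace_det_in_Ints:
  fixes A :: "rat mat"
  assumes A: "A \<in> carrier_mat 2 2" and n: "n \<in> integrality_exponents A" "n > 0"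
  shows "A $$ (0, 0) + A $$ (1, 1) \<in> \<int>"
    and "A $$ (0, 0) * A $$ (1, 1) - A $$ (0, 1) * A $$ (1, 0) \<in> \<int>"
proof -
  have int: "(A ^\<^sub>m n) $$ (i, j) \<in> \<int>" if "i < 2" "j < 2" for i j
    using n(1) that by (simp add: mem_integrality_exponents_iff[OF A])
  let ?D = "A $$ (0, 0) * A $$ (1, 1) - A $$ (0, 1) * A $$ (1, 0)"
  have "?D ^ n \<in> \<int>"
    unfolding pow_mat_det_2[OF A, symmetric] by (intro Ints_diff Ints_mult int) simp_all
  then show D: "?D \<in> \<int>"
    using n(2) by (rule rat_in_Ints_if_power_in_Ints)
  \<comment> \<open>Traces of the powers: the initial value 2 is the trace of the identity, and
    adding diagonal entries in Cayley-Hamilton gives the recurrence.\<close>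
  define V where "V k = (A ^\<^sub>m k) $$ (0, 0) + (A ^\<^sub>m k) $$ (1, 1)" for k
  show "A $$ (0, 0) + A $$ (1, 1) \<in> \<int>"
  proof (rule rat_in_Ints_if_companion_in_Ints[of V _ ?D n])
    show "V 0 = 2" "V (Suc 0) = A $$ (0, 0) + A $$ (1, 1)"
      using A by (simp_all add: V_def)
    show "V (Suc (Suc k)) = (A $$ (0, 0) + A $$ (1, 1)) * V (Suc k) - ?D * V k" for k
      by (simp add: V_def pow_mat_cayley_hamilton_2[OF A] algebra_simps del: pow_mat.simps)
    show "V n \<in> \<int>"
      unfolding V_def by (intro Ints_add int) simp_all
  qed (use D n in auto)
qed

section \<open>The two directions of the equivalence\<close>

text \<open>Covers matrices without an integral positive power, whose trace and determinant may fail
  to be integers. With \<open>P = 1\<close> and \<open>Q = 0\<close> every later Lucas number is 1,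
  so \<open>R = 1 / 2\<close> rejects all \<open>n > 0\<close>.\<close>

lemma lucas_semigroup_zero: "lucas_semigroup {0}"
proof -
  have U: "lucas_U 1 0 (Suc n) = 1" for n
    by (induction n) simp_all
  have half: "(1 / 2 :: rat) \<notin> \<int>"
    using of_int_div_of_int_in_Ints_iff[of 1 2, where ?'a = rat] by simp
  have "n \<in> lucas_set 1 0 (1 / 2) \<longleftrightarrow> n = 0" for n
    using half by (cases n) (simp_all add: lucas_set_def U del: lucas_U.simps(3))
  then have "{0} = lucas_set 1 0 (1 / 2)"
    by blast
  then show ?thesis
    unfolding lucas_semigroup_def by blast
qed

lemma lucas_semigroup_integrality_exponents:
  fixes A :: "rat mat"
  assumes A: "A \<in> carrier_mat 2 2"
  shows "lucas_semigroup (integrality_exponents A)"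
proof (cases "\<exists>n\<in>integrality_exponents A. n > 0")
  case False
  moreover have "0 \<in> integrality_exponents A"
    using A by (simp add: mem_integrality_exponents_iff)
  ultimately have "integrality_exponents A = {0}"
    by auto
  then show ?thesis
    using lucas_semigroup_zero by simp
next
  case True
  then obtain P Q where T: "A $$ (0, 0) + A $$ (1, 1) = of_int P"
    and D: "A $$ (0, 0) * A $$ (1, 1) - A $$ (0, 1) * A $$ (1, 0) = of_int Q"
    using trace_det_in_Ints[OF A] by (metis Ints_cases)
  have "finite (elements_mat A)"
    unfolding elements_mat_def by simp
  then obtain s where s: "s \<noteq> 0" "\<And>x. (\<forall>r\<in>elements_mat A. of_int x * r \<in> \<int>) \<longleftrightarrow> s dvd x"
    by (rule common_denominator) blast
  have "n \<in> integrality_exponents A \<longleftrightarrow> n \<in> lucas_set P Q (1 / of_int s)" for n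
  proof -
    have "n \<in> integrality_exponents A \<longleftrightarrow> (\<forall>r\<in>elements_mat A. of_int (lucas_U P Q n) * r \<in> \<int>)"
      unfolding mem_integrality_exponents_iff_lucas_U[OF A T D]
      using A by (auto dest!: elements_matD intro: elements_matI)
    also have "\<dots> \<longleftrightarrow> s dvd lucas_U P Q n"
      by (rule s(2))
    also have "\<dots> \<longleftrightarrow> of_int (lucas_U P Q n) * (1 / of_int s :: rat) \<in> \<int>"
      using s(1) by (simp add: of_int_div_of_int_in_Ints_iff)
    finally show ?thesis
      unfolding lucas_set_def by simp
  qed
  then show ?thesis
    unfolding lucas_semigroup_def by blast
qed

lemma dim_realizable_lucas_set: "dim_realizable 2 (lucas_set P Q R)"
proof -
  obtain r s :: int where s: "s > 0" "coprime r s" "R = of_int r / of_int s"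
    by (rule rat_coprime_quotient)
  \<comment> \<open>The factor \<open>s\<close> in the upper right entry cancels
    \<open>1 / s\<close> in the determinant; all entries except \<open>1 / s\<close> are
    integers.\<close>
  define A :: "rat mat" where
    "A = mat 2 2 (\<lambda>(i, j). if i = 0 then (if j = 0 then 0 else - of_int (Q * s))
      else (if j = 0 then 1 / of_int s else of_int P))"
  have A: "A \<in> carrier_mat 2 2"
    by (simp add: A_def)
  have entries: "A $$ (0, 0) = 0" "A $$ (0, Suc 0) = - of_int (Q * s)"
    "A $$ (Suc 0, 0) = 1 / of_int s" "A $$ (Suc 0, Suc 0) = of_int P"
    by (simp_all add: A_def)
  have T: "A $$ (0, 0) + A $$ (1, 1) = of_int P"
    and D: "A $$ (0, 0) * A $$ (1, 1) - A $$ (0, 1) * A $$ (1, 0) = of_int Q"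
    using s(1) by (simp_all add: entries)
  have "n \<in> integrality_exponents A \<longleftrightarrow> n \<in> lucas_set P Q R" for n
  proof -
    have "n \<in> integrality_exponents A \<longleftrightarrow> of_int (lucas_U P Q n) * (1 / of_int s :: rat) \<in> \<int>"
      unfolding mem_integrality_exponents_iff_lucas_U[OF A T D]
      by (simp add: numeral_2_eq_2 All_less_Suc2 entries)
    also have "\<dots> \<longleftrightarrow> s dvd lucas_U P Q n"
      using s(1) by (simp add: of_int_div_of_int_in_Ints_iff)
    \<comment> \<open>The numerator \<open>r\<close> is coprime to \<open>s\<close>, so
      \<open>R\<close> and \<open>1 / s\<close> are cleared by the same integers.\<close>
    also have "\<dots> \<longleftrightarrow> of_int (lucas_U P Q n) * R \<in> \<int>"
      using of_int_mult_rat_in_Ints_iff[OF _ s(2,3)] s(1) by simp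
    finally show ?thesis
      unfolding lucas_set_def by simp
  qed
  then have "lucas_set P Q R = integrality_exponents A"
    by blast
  then show ?thesis
    using A unfolding dim_realizable_def by blast
qed

theorem theorem6p2:
  fixes S :: "nat set"
  assumes "submonoid_nat S"
  shows "dim_realizable 2 S \<longleftrightarrow> lucas_semigroup S"
proof
  show "lucas_semigroup S" if "dim_realizable 2 S"
    using that lucas_semigroup_integrality_exponents unfolding dim_realizable_def by blast
  show "dim_realizable 2 S" if "lucas_semigroup S"
    using that dim_realizable_lucas_set unfolding lucas_semigroup_def by blast
qed

end
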